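(* Fix $i\in\{1,2,\dots,n\}$ and $s\in\Sigma$ with $P(S=s)>0$, and let $x=M(s)=\sum_{j=1}^n(1-s_j)$. In the symmetric case, let $\alpha_i(s)=P(T_i=0|S=s)$. If $s_i=0$, then $x\in\{1,2,\dots,n\}$ and $$\alpha_i(s)=b\,\frac{n-k}{x}\,\frac{g_{n-1,k}(x-1)}{g_{n,k}(x)}=:\alpha^-(x,k).$$ If $s_i=1$, then $x\in\{0,1,\dots,n-1\}$ and $$\alpha_i(s)=(1-b)\,\frac{n-k}{n-x}\,\frac{g_{n-1,k}(x)}{g_{n,k}(x)}=:\alpha^+(x,k).$$ Moreover, $$x\,\alpha^-(x,k)+(n-x)\,\alpha^+(x,k)=n-k.$$
   Context: Let $n\ge1$, $0\le k\le n$ be integers and $a,b\in[1/2,1]$. Let $\Gamma=\{\gamma\in\{0,1\}^n:\sum_j\gamma_j=k\}$ and $\Sigma=\{0,1\}^n$. In the symmetric case, $T=(T_1,\dots,T_n)$ is uniformly distributed on $\Gamma$, and $S=(S_1,\dots,S_n)\in\Sigma$ is such that, conditionally on $T=\gamma$, the $S_i$ are independent with $P(S_i=1|T=\gamma)=a$ if $\gamma_i=1$ and $P(S_i=0|T=\gamma)=b$ if $\gamma_i=0$. For integers $n'\ge k\ge0$, $g_{n',k}$ denotes the probability mass function of $N_1+N_2$ where $N_1\sim\mathrm{Bin}(k,1-a)$ and $N_2\sim\mathrm{Bin}(n'-k,b)$ are independent. Conventions: when $k=n$ (so that $g_{n-1,k}$ is not defined) the expressions with factor $n-k=0$ equal $0$;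 in the last identity, the term $x\,\alpha^-(x,k)$ is $0$ when $x=0$ and the term $(n-x)\alpha^+(x,k)$ is $0$ when $x=n$. *)

theory Defs
  imports "HOL-Probability.Probability"
begin

definition Sigma01 :: "nat \<Rightarrow> (nat \<Rightarrow> nat) set" where
  "Sigma01 n = {1..n} \<rightarrow>\<^sub>E {0, 1}"

definition Gamma01 :: "nat \<Rightarrow> nat \<Rightarrow> (nat \<Rightarrow> nat) set" where
  "Gamma01 n k = {\<gamma> \<in> Sigma01 n. (\<Sum>j=1..n. \<gamma> j) = k}"

definition num_zeros :: "nat \<Rightarrow> (nat \<Rightarrow> nat) \<Rightarrow> nat" where
  "num_zeros n s = (\<Sum>j=1..n. 1 - s j)"

(* Conditioning on the event {T = \<gamma>} is rendered by the conditional probability measure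
   uniform_measure M {T = \<gamma>}; that event has probability 1 / card (Gamma01 n k) > 0. *)
locale symmetric_case = prob_space M
  for M :: "'w measure" +
  fixes n k :: nat
    and a b :: real
    and T S :: "'w \<Rightarrow> nat \<Rightarrow> nat"
  assumes n_ge_1: "1 \<le> n"
    and k_le_n: "k \<le> n"
    and a_range: "a \<in> {1/2..1}"
    and b_range: "b \<in> {1/2..1}"
    and T_measurable: "T \<in> measurable M (count_space (Sigma01 n))"
    and S_measurable: "S \<in> measurable M (count_space (Sigma01 n))"
    and T_uniform:
      "distr M (count_space UNIV) T = measure_pmf (pmf_of_set (Gamma01 n k))"
    and S_cond_indep: "\<And>\<gamma>. \<gamma> \<in> Gamma01 n k \<Longrightarrow>
      prob_space.indep_vars (uniform_measure M {\<omega> \<in> space M. T \<omega> = \<gamma>})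
        (\<lambda>_. count_space UNIV) (\<lambda>j \<omega>. S \<omega> j) {1..n}"
    and S_cond_1: "\<And>\<gamma> j. \<gamma> \<in> Gamma01 n k \<Longrightarrow> j \<in> {1..n} \<Longrightarrow> \<gamma> j = 1 \<Longrightarrow>
      \<P>(\<omega> in M. S \<omega> j = 1 \<bar> T \<omega> = \<gamma>) = a"
    and S_cond_0: "\<And>\<gamma> j. \<gamma> \<in> Gamma01 n k \<Longrightarrow> j \<in> {1..n} \<Longrightarrow> \<gamma> j = 0 \<Longrightarrow>
      \<P>(\<omega> in M. S \<omega> j = 0 \<bar> T \<omega> = \<gamma>) = b"

(* Only meaningful for k \<le> n'; otherwise the subtraction on nat truncates. *)
definition g_pmf :: "real \<Rightarrow> real \<Rightarrow> nat \<Rightarrow> nat \<Rightarrow> nat \<Rightarrow> real" where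
  "g_pmf a b n' k y =
     pmf (map_pmf (\<lambda>(n1, n2). n1 + n2)
            (pair_pmf (binomial_pmf k (1 - a)) (binomial_pmf (n' - k) b))) y"

(* For k = n both expressions vanish through the factor n - k, whatever g_pmf a b (n - 1) n is.
   The quotients by x = 0 (alpha_minus) and n - x = 0 (alpha_plus) are 0 since y / 0 = 0, and
   x * alpha_minus and (n - x) * alpha_plus are then 0 because of the factor in front. *)
definition alpha_minus :: "real \<Rightarrow> real \<Rightarrow> nat \<Rightarrow> nat \<Rightarrow> nat \<Rightarrow> real" where
  "alpha_minus a b n x k =
     b * ((real n - real k) / real x) * (g_pmf a b (n - 1) k (x - 1) / g_pmf a b n k x)"

definition alpha_plus :: "real \<Rightarrow> real \<Rightarrow> nat \<Rightarrow> nat \<Rightarrow> nat \<Rightarrow> real" where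
  "alpha_plus a b n x k =
     (1 - b) * ((real n - real k) / (real n - real x)) *
       (g_pmf a b (n - 1) k x / g_pmf a b n k x)"

end

theory Submission
  imports Defs
begin

text \<open>
  Identify \<open>\<gamma>\<close> with the set \<open>K\<close> of its ones and \<open>s\<close> with the set \<open>X\<close> of its zeros. Given
  \<open>T = \<gamma>\<close>, the probability of \<open>S = s\<close> is a product over the coordinates, \<open>emission_weight\<close>, so
  by uniformity of \<open>T\<close> the probability of \<open>S = s\<close> is a weight sum over the \<open>k\<close>-subsets of
  \<open>{1..n}\<close>, divided by \<open>n choose k\<close>. The event \<open>T i = 0\<close> says that \<open>i \<notin> K\<close>. Intersecting with
  it restricts the sum to the \<open>k\<close>-subsets of \<open>{1..n} - {i}\<close>, and coordinate \<open>i\<close> contributes the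
  constant factor \<open>b\<close> (if \<open>s i = 0\<close>) or \<open>1 - b\<close> (if \<open>s i = 1\<close>). What remains is the same weight
  sum on \<open>n - 1\<close> coordinates.

  Both weight sums are evaluated by \<open>choose_mult_sum_emission_weight\<close>. By symmetry the sum over
  \<open>K\<close> depends on \<open>X\<close> only through its cardinality \<open>x\<close>, and for fixed \<open>K\<close> the weights of all
  \<open>X\<close> of cardinality \<open>x\<close> add up to \<open>g_pmf\<close> at \<open>x\<close>. Counting the pairs \<open>(K, X)\<close> in both orders
  gives \<open>(m choose x) * Z = (m choose k) * g\<close> for the weight sum \<open>Z\<close> on \<open>m\<close> coordinates. In the
  quotient of the two sums the binomial coefficients cancel, by the absorption identities, to
  \<open>(n - k) / x\<close> or \<open>(n - k) / (n - x)\<close>.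

  The last identity needs no computation with \<open>g_pmf\<close>: its left-hand side is the sum over all
  coordinates of the conditional probabilities that \<open>T\<close> vanishes there, which is the conditional
  expectation of the number of zeros of \<open>T\<close>, and this number is almost surely \<open>n - k\<close>.
\<close>

section \<open>Weighted sums over subsets\<close>

text \<open>
  The probability that the zeros of the observation are exactly \<open>X\<close> when the ones of the hidden
  configuration are exactly \<open>K\<close>, both relative to the coordinates \<open>I\<close>. An arbitrary \<open>I\<close> is
  allowed so that single coordinates can be split off.
\<close>

definition emission_weight ::
    "real \<Rightarrow> real \<Rightarrow> 'i set \<Rightarrow> 'i set \<Rightarrow> 'i set \<Rightarrow> real" where
  "emission_weight a b I X K =
     (\<Prod>j\<in>I. if j \<in> K then (if j \<in> X then 1 - a else a) else (if j \<in> X then b else 1 - b))"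

lemma emission_weight_remove:
  assumes "finite I" "i \<in> I" "i \<notin> K"
  shows "emission_weight a b I X K =
    (if i \<in> X then b else 1 - b) * emission_weight a b (I - {i}) (X - {i}) K"
proof -
  have "emission_weight a b (I - {i}) X K = emission_weight a b (I - {i}) (X - {i}) K"
    unfolding emission_weight_def by (intro prod.cong) auto
  then show ?thesis
    using assms unfolding emission_weight_def by (subst prod.remove[of I i]) auto
qed

text \<open>
  The weight depends only on the numbers of elements of \<open>K\<close> inside and outside \<open>X\<close>. This is the
  symmetry that makes the sums below functions of the cardinality of \<open>X\<close>.
\<close>
lemma emission_weight_card:
  assumes "finite I" "X \<subseteq> I" "K1 \<subseteq> X" "K2 \<subseteq> I - X"
  shows "emission_weight a b I X (K1 \<union> K2) =
    (1 - a) ^ card K1 * b ^ (card X - card K1) *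
    a ^ card K2 * (1 - b) ^ (card I - card X - card K2)"
proof -
  have fin: "finite X" "finite K1" "finite K2"
    using assms by (auto intro: finite_subset)
  have "emission_weight a b I X (K1 \<union> K2) =
    (\<Prod>j\<in>X. if j \<in> K1 then 1 - a else b) * (\<Prod>j\<in>I - X. if j \<in> K2 then a else 1 - b)"
    unfolding emission_weight_def using assms
    by (subst prod.subset_diff[OF assms(2,1)], subst mult.commute,
        intro arg_cong2[of _ _ _ _ "(*)"] prod.cong) auto
  moreover have "(\<Prod>j\<in>X. if j \<in> K1 then 1 - a else b) =
      (1 - a) ^ card K1 * b ^ (card X - card K1)"
    using fin assms by (simp add: prod.If_cases card_Diff_subset Int_absorb1 flip: Diff_eq)
  moreover have "(\<Prod>j\<in>I - X. if j \<in> K2 then a else 1 - b) =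
      a ^ card K2 * (1 - b) ^ (card I - card X - card K2)"
    using fin assms by (simp add: prod.If_cases card_Diff_subset Int_absorb1 flip: Diff_eq)
  ultimately show ?thesis by simp
qed

text \<open>
  A subset \<open>K\<close> splits into \<open>K \<inter> X\<close> and \<open>K - X\<close>; the summation index \<open>l\<close> is the cardinality of
  the first part.
\<close>
lemma sum_emission_weight:
  assumes fin: "finite I" and sub: "X \<subseteq> I"
  shows "(\<Sum>K | K \<subseteq> I \<and> card K = k. emission_weight a b I X K) =
    (\<Sum>l\<le>k. real (card X choose l) * real (card I - card X choose (k - l)) *
      ((1 - a) ^ l * b ^ (card X - l) * a ^ (k - l) *
       (1 - b) ^ (card I - card X - (k - l))))"
proof -
  have finX: "finite X" using fin sub by (rule finite_subset[rotated])
  let ?P = "\<lambda>l. {K1. K1 \<subseteq> X \<and> card K1 = l} \<times> {K2. K2 \<subseteq> I - X \<and> card K2 = k - l}"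
  have finP: "finite (?P l)" for l
    using fin finX by simp
  have "(\<Sum>K | K \<subseteq> I \<and> card K = k. emission_weight a b I X K) =
    (\<Sum>(l, K1, K2)\<in>(SIGMA l:{..k}. ?P l). emission_weight a b I X (K1 \<union> K2))"
  proof (rule sum.reindex_bij_witness
      [where i = "\<lambda>(l, K1, K2). K1 \<union> K2" and j = "\<lambda>K. (card (K \<inter> X), K \<inter> X, K - X)"])
    fix K assume "K \<in> {K. K \<subseteq> I \<and> card K = k}"
    then have K: "K \<subseteq> I" "card K = k" and finK: "finite K"
      using fin by (auto intro: finite_subset)
    have "card (K - X) = k - card (K \<inter> X)"
      using K(2) finK by (metis card_Diff_subset_Int finite_Int)
    moreover have "card (K \<inter> X) \<le> k"
      using K(2) finK by (metis card_mono Int_lower1)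
    ultimately show "(card (K \<inter> X), K \<inter> X, K - X) \<in> (SIGMA l:{..k}. ?P l)"
      using K by auto
    show "(case (card (K \<inter> X), K \<inter> X, K - X) of (l, K1, K2) \<Rightarrow> K1 \<union> K2) = K"
      by auto
    show "(case (card (K \<inter> X), K \<inter> X, K - X) of
        (l, K1, K2) \<Rightarrow> emission_weight a b I X (K1 \<union> K2)) = emission_weight a b I X K"
      by (simp add: Int_Diff_Un)
  next
    fix p assume "p \<in> (SIGMA l:{..k}. ?P l)"
    then obtain K1 K2 where p: "p = (card K1, K1, K2)" "card K1 \<le> k"
      "K1 \<subseteq> X" "K2 \<subseteq> I - X" "card K2 = k - card K1"
      by auto
    have "finite K1" "finite K2"
      using fin finX p by (auto intro: finite_subset)
    then have "card (K1 \<union> K2) = k"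
      using p by (subst card_Un_disjoint) auto
    then show "(case p of (l, K1, K2) \<Rightarrow> K1 \<union> K2) \<in> {K. K \<subseteq> I \<and> card K = k}"
      using p sub by auto
    have "(K1 \<union> K2) \<inter> X = K1" "(K1 \<union> K2) - X = K2"
      using p by auto
    then show "(card ((case p of (l, K1, K2) \<Rightarrow> K1 \<union> K2) \<inter> X),
        (case p of (l, K1, K2) \<Rightarrow> K1 \<union> K2) \<inter> X,
        (case p of (l, K1, K2) \<Rightarrow> K1 \<union> K2) - X) = p"
      using p(1) by simp
  qed
  also have "\<dots> = (\<Sum>l\<le>k. \<Sum>(K1, K2)\<in>?P l. emission_weight a b I X (K1 \<union> K2))"
    using finP by (subst sum.Sigma) auto
  also have "\<dots> = (\<Sum>l\<le>k. \<Sum>(K1, K2)\<in>?P l. (1 - a) ^ l * b ^ (card X - l) * a ^ (k - l) *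
       (1 - b) ^ (card I - card X - (k - l)))"
    by (intro sum.cong refl) (auto simp: emission_weight_card[OF fin sub])
  also have "\<dots> = (\<Sum>l\<le>k. real (card X choose l) * real (card I - card X choose (k - l)) *
      ((1 - a) ^ l * b ^ (card X - l) * a ^ (k - l) *
       (1 - b) ^ (card I - card X - (k - l))))"
    using fin finX sub
    by (intro sum.cong refl)
       (simp add: case_prod_unfold card_cartesian_product n_subsets card_Diff_subset)
  finally show ?thesis .
qed

text \<open>
  Both sides count the pairs of an \<open>x\<close>-subset and a \<open>k\<close>-subset of an \<open>m\<close>-set that meet in exactly
  \<open>l\<close> points, the left one choosing the \<open>x\<close>-subset first and the right one the \<open>k\<close>-subset.
\<close>
lemma choose_mult_choose_swap:
  fixes m x k l :: nat
  assumes "x \<le> m" "k \<le> m" "l \<le> x" "l \<le> k"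
  shows "(m choose x) * ((x choose l) * (m - x choose (k - l))) =
         (m choose k) * ((k choose l) * (m - k choose (x - l)))"
proof (cases "k - l \<le> m - x")
  case True
  then have le: "x - l \<le> m - k" using assms by linarith
  have eq: "m - x - (k - l) = m - k - (x - l)" using assms by linarith
  have "real ((m choose x) * ((x choose l) * (m - x choose (k - l)))) =
        real ((m choose k) * ((k choose l) * (m - k choose (x - l))))"
    using assms True le by (simp add: binomial_fact eq field_simps)
  then show ?thesis using of_nat_eq_iff by blast
next
  case False
  then have "m - k < x - l" using assms by linarith
  then show ?thesis using False by (simp add: binomial_eq_0)
qed

lemma pmf_add_pair_pmf:
  fixes p q :: "nat pmf"
  shows "pmf (map_pmf (\<lambda>(u, v). u + v) (pair_pmf p q)) y =
    (\<Sum>l\<le>y. pmf p l * pmf q (y - l))"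
proof -
  have "(\<lambda>(u, v). u + v) -` {y} = (\<lambda>l. (l, y - l)) ` {..y}"
    by (auto simp: image_iff)
  then have "pmf (map_pmf (\<lambda>(u, v). u + v) (pair_pmf p q)) y =
      (\<Sum>r\<in>(\<lambda>l. (l, y - l)) ` {..y}. pmf (pair_pmf p q) r)"
    by (simp add: pmf_map measure_measure_pmf_finite)
  also have "\<dots> = (\<Sum>l\<le>y. pmf p l * pmf q (y - l))"
    by (subst sum.reindex) (auto simp: inj_on_def pmf_pair)
  finally show ?thesis .
qed

text \<open>
  Both sides are the total weight of all pairs of a \<open>k\<close>-subset \<open>K\<close> and a set of zeros with as many
  elements as \<open>X\<close>. On the left every set of zeros has the same sum over \<open>K\<close>; on the right every
  \<open>K\<close> has the same sum over the sets of zeros, the probability that the number of zeros equals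
  \<open>card X\<close>. Written out by \<open>l = card (K \<inter> X)\<close>, the two sides agree term by term.
  For \<open>k > card I\<close> both sides vanish, whatever value \<open>g_pmf\<close> has there; this covers the
  case \<open>k = n\<close> on \<open>n - 1\<close> coordinates.
\<close>
lemma choose_mult_sum_emission_weight:
  assumes fin: "finite I" and sub: "X \<subseteq> I"
    and a: "a \<in> {0..1}" and b: "b \<in> {0..1}"
  shows "real (card I choose card X) * (\<Sum>K | K \<subseteq> I \<and> card K = k. emission_weight a b I X K) =
    real (card I choose k) * g_pmf a b (card I) k (card X)"
proof (cases "k \<le> card I")
  case False
  then have "{K. K \<subseteq> I \<and> card K = k} = {}"
    using card_mono[OF fin] by auto
  then show ?thesis using False by (simp only: sum.empty) (simp add: binomial_eq_0)
next
  case k: True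
  define m x where "m = card I" and "x = card X"
  have x: "x \<le> m" unfolding m_def x_def using fin sub by (rule card_mono)
  note k = k[folded m_def]
  let ?r = "\<lambda>l. (1 - a) ^ l * b ^ (x - l) * a ^ (k - l) * (1 - b) ^ (m - x - (k - l))"
  have "real (m choose x) * (\<Sum>K | K \<subseteq> I \<and> card K = k. emission_weight a b I X K) =
      real (m choose x) *
      (\<Sum>l\<le>k. real (x choose l) * real (m - x choose (k - l)) * ?r l)"
    unfolding sum_emission_weight[OF fin sub] m_def x_def ..
  (* The swap of binomial coefficients can fail for l > k or l > x, because subtraction truncates.
     The terms with such l vanish, in this sum and in the convolution that defines g_pmf, so both
     sums are cut down to l \<le> min k x. *)
  also have "\<dots> = real (m choose x) *
      (\<Sum>l\<le>min k x. real (x choose l) * real (m - x choose (k - l)) * ?r l)"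
    by (intro arg_cong2[of _ _ _ _ "(*)"] refl sum.mono_neutral_right) (auto simp: binomial_eq_0)
  also have "\<dots> = (\<Sum>l\<le>min k x.
      real ((m choose x) * ((x choose l) * (m - x choose (k - l)))) * ?r l)"
    by (simp add: sum_distrib_left mult.assoc)
  also have "\<dots> = (\<Sum>l\<le>min k x.
      real ((m choose k) * ((k choose l) * (m - k choose (x - l)))) * ?r l)"
    using x k by (intro sum.cong refl) (simp only: choose_mult_choose_swap atMost_iff min.bounded_iff)
  also have "\<dots> = real (m choose k) *
      (\<Sum>l\<le>min k x. pmf (binomial_pmf k (1 - a)) l * pmf (binomial_pmf (m - k) b) (x - l))"
  proof -
    have "m - x - (k - l) = m - k - (x - l)" if "l \<le> k" "l \<le> x" for l
      using that x k by linarith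
    then show ?thesis
      unfolding sum_distrib_left using a b
      by (intro sum.cong refl) (simp add: pmf_binomial)
  qed
  also have "\<dots> = real (m choose k) *
      (\<Sum>l\<le>x. pmf (binomial_pmf k (1 - a)) l * pmf (binomial_pmf (m - k) b) (x - l))"
    using a by (intro arg_cong2[of _ _ _ _ "(*)"] refl sum.mono_neutral_left)
       (auto simp: binomial_eq_0 pmf_binomial)
  also have "\<dots> = real (m choose k) * g_pmf a b m k x"
    by (simp add: g_pmf_def pmf_add_pair_pmf)
  finally show ?thesis unfolding m_def x_def .
qed

section \<open>Configurations as sets of coordinates\<close>

text \<open>
  The set \<open>J\<close> serves two cases: \<open>J = {1..n}\<close> gives all of \<open>Gamma01 n k\<close>, and
  \<open>J = {1..n} - {i}\<close> gives the configurations that vanish at \<open>i\<close>.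
\<close>
lemma bij_betw_Gamma01_subsets:
  assumes J: "J \<subseteq> {1..n}"
  shows "bij_betw (\<lambda>\<gamma>. {j \<in> {1..n}. \<gamma> j = 1})
    {\<gamma> \<in> Gamma01 n k. \<forall>j\<in>{1..n} - J. \<gamma> j = 0} {K. K \<subseteq> J \<and> card K = k}"
proof -
  have sum_card: "(\<Sum>j=1..n. \<gamma> j) = card {j \<in> {1..n}. \<gamma> j = 1}" if "\<gamma> \<in> Sigma01 n" for \<gamma>
  proof -
    have "(\<Sum>j=1..n. \<gamma> j) = (\<Sum>j=1..n. if \<gamma> j = 1 then 1 else 0)"
      using that by (intro sum.cong refl) (auto simp: Sigma01_def PiE_iff)
    then show ?thesis by (simp flip: sum.inter_filter)
  qed
  show ?thesis
  proof (rule bij_betw_byWitness[where f' = "\<lambda>K. \<lambda>j\<in>{1..n}. if j \<in> K then 1 else 0"])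
    show "\<forall>\<gamma>\<in>{\<gamma> \<in> Gamma01 n k. \<forall>j\<in>{1..n} - J. \<gamma> j = 0}.
        (\<lambda>j\<in>{1..n}. if j \<in> {j \<in> {1..n}. \<gamma> j = 1} then 1 else 0) = \<gamma>"
      by (force simp: Gamma01_def Sigma01_def PiE_iff extensional_def fun_eq_iff)
    show "\<forall>K\<in>{K. K \<subseteq> J \<and> card K = k}.
        {j \<in> {1..n}. (\<lambda>j\<in>{1..n}. if j \<in> K then 1 else 0) j = (1::nat)} = K"
      using J by auto
    show "(\<lambda>\<gamma>. {j \<in> {1..n}. \<gamma> j = 1}) ` {\<gamma> \<in> Gamma01 n k. \<forall>j\<in>{1..n} - J. \<gamma> j = 0}
        \<subseteq> {K. K \<subseteq> J \<and> card K = k}"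
      using sum_card by (force simp: Gamma01_def)
    show "(\<lambda>K. \<lambda>j\<in>{1..n}. if j \<in> K then 1 else 0) ` {K. K \<subseteq> J \<and> card K = k}
        \<subseteq> {\<gamma> \<in> Gamma01 n k. \<forall>j\<in>{1..n} - J. \<gamma> j = 0}"
    proof safe
      fix K assume K: "K \<subseteq> J" "k = card K"
      let ?\<gamma> = "\<lambda>j\<in>{1..n}. if j \<in> K then 1 else (0::nat)"
      have \<gamma>: "?\<gamma> \<in> Sigma01 n" by (auto simp: Sigma01_def)
      have "{j \<in> {1..n}. ?\<gamma> j = 1} = K" using K J by auto
      then show "?\<gamma> \<in> Gamma01 n (card K)"
        using sum_card[OF \<gamma>] \<gamma> by (simp add: Gamma01_def)
      show "?\<gamma> j = 0" if "j \<in> {1..n}" "j \<notin> J" for j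
        using that K by auto
    qed
  qed
qed

lemma finite_Sigma01: "finite (Sigma01 n)"
  unfolding Sigma01_def by (intro finite_PiE) auto

lemma card_Gamma01: "card (Gamma01 n k) = n choose k"
  using bij_betw_same_card[OF bij_betw_Gamma01_subsets[of "{1..n}" n k]]
  by (simp add: n_subsets)

lemma Sigma01_values: "\<gamma> \<in> Sigma01 n \<Longrightarrow> j \<in> {1..n} \<Longrightarrow> \<gamma> j = 0 \<or> \<gamma> j = 1"
  by (auto simp: Sigma01_def PiE_iff)

lemma num_zeros_le: "num_zeros n s \<le> n"
  using sum_mono[of "{1..n}" "\<lambda>j. 1 - s j" "\<lambda>_. 1"] by (simp add: num_zeros_def)

lemma num_zeros_eq_card:
  assumes "s \<in> Sigma01 n"
  shows "num_zeros n s = card {j \<in> {1..n}. s j = 0}"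
proof -
  have "num_zeros n s = (\<Sum>j=1..n. if s j = 0 then 1 else 0)"
    unfolding num_zeros_def
    using assms by (intro sum.cong refl) (auto simp: Sigma01_def PiE_iff)
  then show ?thesis by (simp flip: sum.inter_filter)
qed


section \<open>The joint law of the hidden and the observed configuration\<close>

context symmetric_case
begin

lemma finite_Gamma01: "finite (Gamma01 n k)"
  unfolding Gamma01_def using finite_Sigma01 by auto

lemma Gamma01_nonempty: "Gamma01 n k \<noteq> {}"
proof
  assume "Gamma01 n k = {}"
  then have "n choose k = 0" using card_Gamma01[of n k] by simp
  then show False using k_le_n by simp
qed

lemma T_S_events:
  "{\<omega> \<in> space M. P (T \<omega>)} \<in> events" "{\<omega> \<in> space M. P (S \<omega>)} \<in> events"
  using measurable_compose[OF T_measurable, of P "count_space UNIV"]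
    measurable_compose[OF S_measurable, of P "count_space UNIV"]
  by (auto simp: pred_def)

lemma T_in_Sigma01: "\<omega> \<in> space M \<Longrightarrow> T \<omega> \<in> Sigma01 n"
  and S_in_Sigma01: "\<omega> \<in> space M \<Longrightarrow> S \<omega> \<in> Sigma01 n"
  using measurable_space[OF T_measurable] measurable_space[OF S_measurable] by auto

lemma prob_T:
  "\<P>(\<omega> in M. T \<omega> = \<gamma>) = indicator (Gamma01 n k) \<gamma> / real (n choose k)"
proof -
  have T: "T \<in> measurable M (count_space UNIV)"
    using measurable_compose[OF T_measurable, of id "count_space UNIV"] by simp
  have "\<P>(\<omega> in M. T \<omega> = \<gamma>) = measure (distr M (count_space UNIV) T) {\<gamma>}"
    using T by (simp add: measure_distr vimage_def Int_def conj_commute)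
  also have "\<dots> = pmf (pmf_of_set (Gamma01 n k)) \<gamma>"
    by (simp add: T_uniform measure_pmf_single)
  finally show ?thesis
    by (simp add: pmf_of_set[OF Gamma01_nonempty finite_Gamma01] card_Gamma01)
qed

lemma cond_prob_coordinate:
  assumes \<gamma>: "\<gamma> \<in> Gamma01 n k" and j: "j \<in> {1..n}" and s: "s \<in> Sigma01 n"
  shows "\<P>(\<omega> in M. S \<omega> j = s j \<bar> T \<omega> = \<gamma>) =
    (if \<gamma> j = 1 then (if s j = 0 then 1 - a else a) else (if s j = 0 then b else 1 - b))"
proof -
  have T_pos: "\<P>(\<omega> in M. T \<omega> = \<gamma>) \<noteq> 0"
    using \<gamma> k_le_n by (simp add: prob_T)
  have complement: "\<P>(\<omega> in M. S \<omega> j = 0 \<bar> T \<omega> = \<gamma>) = 1 - \<P>(\<omega> in M. S \<omega> j = 1 \<bar> T \<omega> = \<gamma>)"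
  proof -
    have "{\<omega> \<in> space M. T \<omega> = \<gamma>} =
        {\<omega> \<in> space M. S \<omega> j = 0 \<and> T \<omega> = \<gamma>} \<union> {\<omega> \<in> space M. S \<omega> j = 1 \<and> T \<omega> = \<gamma>}"
      using Sigma01_values[OF S_in_Sigma01 j] by auto
    moreover have "prob ({\<omega> \<in> space M. S \<omega> j = 0 \<and> T \<omega> = \<gamma>} \<union>
          {\<omega> \<in> space M. S \<omega> j = 1 \<and> T \<omega> = \<gamma>}) =
        \<P>(\<omega> in M. S \<omega> j = 0 \<and> T \<omega> = \<gamma>) + \<P>(\<omega> in M. S \<omega> j = 1 \<and> T \<omega> = \<gamma>)"
      by (rule finite_measure_Union)
         (auto intro!: sets.sets_Collect_conj T_S_events(1)[of "\<lambda>t. t = \<gamma>"]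
            T_S_events(2)[of "\<lambda>t. t j = 0"] T_S_events(2)[of "\<lambda>t. t j = Suc 0"])
    ultimately have "\<P>(\<omega> in M. T \<omega> = \<gamma>) =
        \<P>(\<omega> in M. S \<omega> j = 0 \<and> T \<omega> = \<gamma>) + \<P>(\<omega> in M. S \<omega> j = 1 \<and> T \<omega> = \<gamma>)"
      by simp
    then show ?thesis using T_pos by (simp add: cond_prob_def field_simps)
  qed
  have "\<gamma> j \<in> {0, 1}" "s j \<in> {0, 1}"
    using \<gamma> s j by (auto simp: Gamma01_def Sigma01_def)
  then show ?thesis
    using S_cond_1[OF \<gamma> j] S_cond_0[OF \<gamma> j] complement by auto
qed

lemma joint_prob:
  assumes \<gamma>: "\<gamma> \<in> Gamma01 n k" and s: "s \<in> Sigma01 n"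
  shows "\<P>(\<omega> in M. T \<omega> = \<gamma> \<and> S \<omega> = s) =
    emission_weight a b {1..n} {j \<in> {1..n}. s j = 0} {j \<in> {1..n}. \<gamma> j = 1} / real (n choose k)"
proof -
  let ?A = "{\<omega> \<in> space M. T \<omega> = \<gamma>}"
  let ?U = "uniform_measure M ?A"
  have A: "prob ?A = 1 / real (n choose k)" and A_pos: "prob ?A > 0"
    using \<gamma> k_le_n by (simp_all add: prob_T)
  then have "emeasure M ?A \<noteq> 0" by (simp add: emeasure_eq_measure)
  then interpret U: prob_space ?U
    by (intro prob_space_uniform_measure) auto
  have cond: "measure ?U {\<omega> \<in> space M. Q (S \<omega>)} = \<P>(\<omega> in M. Q (S \<omega>) \<bar> T \<omega> = \<gamma>)" for Q
    using A_pos by (subst measure_uniform_measure)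
      (auto simp: cond_prob_def emeasure_eq_measure intro!: T_S_events arg_cong[where f = prob])
  have "\<P>(\<omega> in M. S \<omega> = s \<bar> T \<omega> = \<gamma>) = measure ?U {\<omega> \<in> space M. S \<omega> = s}"
    by (rule cond[symmetric])
  (* S and s are both extensional on {1..n}, so agreement on these coordinates is equality. *)
  also have "{\<omega> \<in> space M. S \<omega> = s} = (\<Inter>j\<in>{1..n}. (\<lambda>\<omega>. S \<omega> j) -` {s j} \<inter> space ?U)"
  proof -
    have "S \<omega> = s" if "\<omega> \<in> space M" "\<forall>j\<in>{1..n}. S \<omega> j = s j" for \<omega>
      using that S_in_Sigma01[of \<omega>] s unfolding Sigma01_def by (intro PiE_ext) auto
    then show ?thesis using n_ge_1 by auto
  qed
  also have "measure ?U \<dots> = (\<Prod>j\<in>{1..n}. measure ?U ((\<lambda>\<omega>. S \<omega> j) -` {s j} \<inter> space ?U))"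
    using n_ge_1 by (intro U.indep_varsD[OF S_cond_indep[OF \<gamma>]]) auto
  also have "\<dots> = (\<Prod>j\<in>{1..n}. \<P>(\<omega> in M. S \<omega> j = s j \<bar> T \<omega> = \<gamma>))"
  proof (intro prod.cong refl)
    fix j
    have "(\<lambda>\<omega>. S \<omega> j) -` {s j} \<inter> space ?U = {\<omega> \<in> space M. S \<omega> j = s j}"
      by auto
    then show "measure ?U ((\<lambda>\<omega>. S \<omega> j) -` {s j} \<inter> space ?U) =
        \<P>(\<omega> in M. S \<omega> j = s j \<bar> T \<omega> = \<gamma>)"
      using cond[of "\<lambda>t. t j = s j"] by simp
  qed
  also have "\<dots> = emission_weight a b {1..n} {j \<in> {1..n}. s j = 0} {j \<in> {1..n}. \<gamma> j = 1}"
    unfolding emission_weight_def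
    by (intro prod.cong refl) (simp add: cond_prob_coordinate[OF \<gamma> _ s])
  finally show ?thesis
    by (simp add: cond_prob_def A conj_commute[of "S _ = s"] mult.commute eq_divide_eq k_le_n not_less)
qed

text \<open>
  The values of \<open>T\<close> partition the sample space into finitely many events, and those outside
  \<open>Gamma01 n k\<close> are null sets.
\<close>
lemma prob_T_S_eq_sum:
  "\<P>(\<omega> in M. Q (T \<omega>) \<and> S \<omega> = s) =
    (\<Sum>\<gamma>\<in>{\<gamma> \<in> Gamma01 n k. Q \<gamma>}. \<P>(\<omega> in M. T \<omega> = \<gamma> \<and> S \<omega> = s))"
proof -
  have ev: "{\<omega> \<in> space M. T \<omega> = \<gamma> \<and> S \<omega> = s} \<in> events" for \<gamma>
    by (intro sets.sets_Collect_conj T_S_events)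
  have "\<P>(\<omega> in M. T \<omega> = \<gamma> \<and> S \<omega> = s) = 0" if "\<gamma> \<notin> Gamma01 n k" for \<gamma>
  proof -
    have "\<P>(\<omega> in M. T \<omega> = \<gamma> \<and> S \<omega> = s) \<le> \<P>(\<omega> in M. T \<omega> = \<gamma>)"
      by (intro finite_measure_mono T_S_events) auto
    then show ?thesis
      using that measure_nonneg[of M "{\<omega> \<in> space M. T \<omega> = \<gamma> \<and> S \<omega> = s}"] by (simp add: prob_T)
  qed
  moreover have "{\<omega> \<in> space M. Q (T \<omega>) \<and> S \<omega> = s} =
      (\<Union>\<gamma>\<in>{\<gamma> \<in> Sigma01 n. Q \<gamma>}. {\<omega> \<in> space M. T \<omega> = \<gamma> \<and> S \<omega> = s})"
    using T_in_Sigma01 by auto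
  then have "\<P>(\<omega> in M. Q (T \<omega>) \<and> S \<omega> = s) =
      (\<Sum>\<gamma>\<in>{\<gamma> \<in> Sigma01 n. Q \<gamma>}. \<P>(\<omega> in M. T \<omega> = \<gamma> \<and> S \<omega> = s))"
    using finite_Sigma01 ev
    by (simp only:) (intro finite_measure_finite_Union, auto simp: disjoint_family_on_def)
  ultimately show ?thesis
    using finite_Sigma01
    by (simp only:) (intro sum.mono_neutral_right, auto simp: Gamma01_def)
qed

lemma prob_zero_outside_and_S:
  assumes J: "J \<subseteq> {1..n}" and s: "s \<in> Sigma01 n"
  shows "\<P>(\<omega> in M. (\<forall>j\<in>{1..n} - J. T \<omega> j = 0) \<and> S \<omega> = s) =
    (\<Sum>K | K \<subseteq> J \<and> card K = k. emission_weight a b {1..n} {j \<in> {1..n}. s j = 0} K) /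
      real (n choose k)"
proof -
  let ?w = "emission_weight a b {1..n} {j \<in> {1..n}. s j = 0}"
  have "\<P>(\<omega> in M. (\<forall>j\<in>{1..n} - J. T \<omega> j = 0) \<and> S \<omega> = s) =
      (\<Sum>\<gamma>\<in>{\<gamma> \<in> Gamma01 n k. \<forall>j\<in>{1..n} - J. \<gamma> j = 0}. ?w {j \<in> {1..n}. \<gamma> j = 1}) /
      real (n choose k)"
    unfolding prob_T_S_eq_sum[of "\<lambda>\<gamma>. \<forall>j\<in>{1..n} - J. \<gamma> j = 0"] sum_divide_distrib
    by (intro sum.cong refl) (simp add: joint_prob[OF _ s])
  also have "\<dots> = (\<Sum>K | K \<subseteq> J \<and> card K = k. ?w K) / real (n choose k)"
    by (subst sum.reindex_bij_betw[OF bij_betw_Gamma01_subsets[OF J]]) simp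
  finally show ?thesis .
qed

lemma ab_unit: "a \<in> {0..1}" "b \<in> {0..1}"
  using a_range b_range by auto

lemma prob_S:
  assumes s: "s \<in> Sigma01 n"
  shows "real (n choose num_zeros n s) * \<P>(\<omega> in M. S \<omega> = s) = g_pmf a b n k (num_zeros n s)"
proof -
  let ?X = "{j \<in> {1..n}. s j = 0}"
  let ?Z = "\<Sum>K | K \<subseteq> {1..n} \<and> card K = k. emission_weight a b {1..n} ?X K"
  have pos: "real (n choose k) \<noteq> 0" using k_le_n by simp
  have "real (card {1..n} choose card ?X) * ?Z =
      real (card {1..n} choose k) * g_pmf a b (card {1..n}) k (card ?X)"
    by (rule choose_mult_sum_emission_weight) (use ab_unit in auto)
  then have Z: "real (n choose num_zeros n s) * ?Z =
      real (n choose k) * g_pmf a b n k (num_zeros n s)"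
    by (simp only: num_zeros_eq_card[OF s] card_atLeastAtMost diff_Suc_1)
  have "\<P>(\<omega> in M. S \<omega> = s) = ?Z / real (n choose k)"
    using prob_zero_outside_and_S[OF subset_refl s] by simp
  then have "real (n choose num_zeros n s) * \<P>(\<omega> in M. S \<omega> = s) =
      real (n choose num_zeros n s) * ?Z / real (n choose k)"
    by simp
  then show ?thesis
    unfolding Z using pos by simp
qed

text \<open>
  Coordinate \<open>i\<close> contributes a constant factor to every \<open>K\<close> with \<open>i \<notin> K\<close>, so the weight sum on the
  other \<open>n - 1\<close> coordinates remains. The factor \<open>n\<close> on the left comes from
  \<open>n * (n - 1 choose k) = (n - k) * (n choose k)\<close>.
\<close>
lemma prob_T_zero_and_S:
  assumes s: "s \<in> Sigma01 n" and i: "i \<in> {1..n}"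
  defines "x' \<equiv> card ({j \<in> {1..n}. s j = 0} - {i})"
  shows "real n * real (n - 1 choose x') * \<P>(\<omega> in M. T \<omega> i = 0 \<and> S \<omega> = s) =
    (if s i = 0 then b else 1 - b) * (real n - real k) * g_pmf a b (n - 1) k x'"
proof -
  let ?X = "{j \<in> {1..n}. s j = 0}" and ?I = "{1..n} - {i}"
  let ?c = "if s i = 0 then b else 1 - b"
  let ?Z = "\<Sum>K | K \<subseteq> ?I \<and> card K = k. emission_weight a b ?I (?X - {i}) K"
  have I: "card ?I = n - 1" "{1..n} - ?I = {i}"
    using i by auto
  have absorb: "real n * real (n - 1 choose k) = (real n - real k) * real (n choose k)"
  proof (cases "k = n")
    case True
    then show ?thesis using n_ge_1 by (simp add: binomial_eq_0)
  next
    case False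
    then show ?thesis
      using binomial_absorb_comp[of n k] k_le_n
      by (metis of_nat_diff of_nat_mult)
  qed
  have "\<P>(\<omega> in M. T \<omega> i = 0 \<and> S \<omega> = s) = ?c * ?Z / real (n choose k)"
  proof -
    have "(\<Sum>K | K \<subseteq> ?I \<and> card K = k. emission_weight a b {1..n} ?X K) =
        (\<Sum>K | K \<subseteq> ?I \<and> card K = k. ?c * emission_weight a b ?I (?X - {i}) K)"
      using i by (intro sum.cong refl) (subst emission_weight_remove[of _ i]; auto)
    then show ?thesis
      using prob_zero_outside_and_S[of ?I s, OF _ s] I by (simp add: sum_distrib_left)
  qed
  moreover have "real (n - 1 choose x') * ?Z = real (n - 1 choose k) * g_pmf a b (n - 1) k x'"
    unfolding x'_def I(1)[symmetric]
    by (rule choose_mult_sum_emission_weight) (use ab_unit in auto)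
  ultimately have "real n * real (n - 1 choose x') * \<P>(\<omega> in M. T \<omega> i = 0 \<and> S \<omega> = s) =
      real n * ?c * (real (n - 1 choose k) * g_pmf a b (n - 1) k x') / real (n choose k)"
    by (simp add: field_simps)
  also have "\<dots> = ?c * (real n * real (n - 1 choose k)) * g_pmf a b (n - 1) k x' / real (n choose k)"
    by simp
  also have "\<dots> = ?c * (real n - real k) * g_pmf a b (n - 1) k x'"
    unfolding absorb using k_le_n by simp
  finally show ?thesis .
qed

section \<open>The conditional law of a hidden coordinate\<close>

lemma cond_prob_T_zero_given_S:
  assumes s: "s \<in> Sigma01 n" and i: "i \<in> {1..n}"
    and S_pos: "\<P>(\<omega> in M. S \<omega> = s) > 0"
  defines "x \<equiv> num_zeros n s"
    and "\<alpha> \<equiv> \<P>(\<omega> in M. T \<omega> i = 0 \<bar> S \<omega> = s)"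
  shows "s i = 0 \<Longrightarrow> x \<in> {1..n} \<and> \<alpha> = alpha_minus a b n x k"
    and "s i = 1 \<Longrightarrow> x \<in> {0..n - 1} \<and> \<alpha> = alpha_plus a b n x k"
proof -
  let ?X = "{j \<in> {1..n}. s j = 0}"
  have x: "x = card ?X" unfolding x_def by (rule num_zeros_eq_card[OF s])
  have "x \<le> n" unfolding x_def by (rule num_zeros_le)
  have \<alpha>: "\<alpha> = real (n choose x) * \<P>(\<omega> in M. T \<omega> i = 0 \<and> S \<omega> = s) / g_pmf a b n k x"
    using prob_S[OF s] \<open>x \<le> n\<close> unfolding \<alpha>_def x_def[symmetric] cond_prob_def
    by (simp flip: prob_S[OF s, folded x_def])
  note TS = prob_T_zero_and_S[OF s i]
  {
    assume si: "s i = 0"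
    then have i': "i \<in> ?X" using i by simp
    then have "x > 0" unfolding x by (auto simp: card_gt_0_iff)
    have "card (?X - {i}) = x - 1" using i' x by simp
    then have P: "real n * real (n - 1 choose (x - 1)) * \<P>(\<omega> in M. T \<omega> i = 0 \<and> S \<omega> = s) =
        b * (real n - real k) * g_pmf a b (n - 1) k (x - 1)"
      using TS si by simp
    have "real x * real (n choose x) = real n * real (n - 1 choose (x - 1))"
      using binomial_absorption[of "x - 1" "n"] \<open>x > 0\<close>
      by (metis Suc_diff_1 of_nat_mult)
    then have "real (n choose x) = real n * real (n - 1 choose (x - 1)) / real x"
      using \<open>x > 0\<close> by (simp add: field_simps)
    then have "\<alpha> = alpha_minus a b n x k"
      unfolding \<alpha> alpha_minus_def using P by (simp add: field_simps)
    then show "x \<in> {1..n} \<and> \<alpha> = alpha_minus a b n x k"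
      using \<open>x > 0\<close> \<open>x \<le> n\<close> by simp
  next
    assume si: "s i = 1"
    then have i': "i \<notin> ?X" by simp
    then have "?X \<subset> {1..n}" using i by blast
    then have "x < n" unfolding x using psubset_card_mono[of "{1..n}" ?X] by simp
    have "?X - {i} = ?X" using i' by blast
    then have P: "real n * real (n - 1 choose x) * \<P>(\<omega> in M. T \<omega> i = 0 \<and> S \<omega> = s) =
        (1 - b) * (real n - real k) * g_pmf a b (n - 1) k x"
      using TS si by (simp add: x)
    have "(real n - real x) * real (n choose x) = real n * real (n - 1 choose x)"
      using binomial_absorb_comp[of n x] \<open>x \<le> n\<close> by (metis of_nat_diff of_nat_mult)
    then have "real (n choose x) = real n * real (n - 1 choose x) / (real n - real x)"
      using \<open>x < n\<close> by (simp add: field_simps)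
    then have "\<alpha> = alpha_plus a b n x k"
      unfolding \<alpha> alpha_plus_def using P by (simp add: field_simps)
    then show "x \<in> {0..n - 1} \<and> \<alpha> = alpha_plus a b n x k"
      using \<open>x < n\<close> by simp
  }
qed

text \<open>
  This is linearity of the conditional expectation: the number of zeros of \<open>T\<close> is almost surely
  \<open>n - k\<close>.
\<close>
lemma sum_cond_prob_T_zero_given_S:
  assumes S_pos: "\<P>(\<omega> in M. S \<omega> = s) > 0"
  shows "(\<Sum>j=1..n. \<P>(\<omega> in M. T \<omega> j = 0 \<bar> S \<omega> = s)) = real n - real k"
proof -
  let ?p = "\<lambda>\<gamma>. \<P>(\<omega> in M. T \<omega> = \<gamma> \<and> S \<omega> = s)"
  have zeros: "(\<Sum>j=1..n. if \<gamma> j = 0 then 1 else 0) = real n - real k"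
    if \<gamma>: "\<gamma> \<in> Gamma01 n k" for \<gamma>
  proof -
    have "(\<Sum>j=1..n. if \<gamma> j = 0 then 1 else 0) = (\<Sum>j=1..n. 1 - real (\<gamma> j))"
      using \<gamma> Sigma01_values[of \<gamma> n] by (intro sum.cong refl) (force simp: Gamma01_def)
    also have "\<dots> = real n - real (\<Sum>j=1..n. \<gamma> j)"
      by (simp add: sum_subtractf)
    also have "(\<Sum>j=1..n. \<gamma> j) = k"
      using \<gamma> by (simp add: Gamma01_def)
    finally show ?thesis .
  qed
  have "(\<Sum>j=1..n. \<P>(\<omega> in M. T \<omega> j = 0 \<and> S \<omega> = s)) =
      (\<Sum>j=1..n. \<Sum>\<gamma>\<in>Gamma01 n k. if \<gamma> j = 0 then ?p \<gamma> else 0)"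
    using prob_T_S_eq_sum[of "\<lambda>\<gamma>. \<gamma> _ = 0" s] finite_Gamma01
    by (intro sum.cong refl) (simp add: sum.inter_filter)
  also have "\<dots> = (\<Sum>\<gamma>\<in>Gamma01 n k. (\<Sum>j=1..n. if \<gamma> j = 0 then 1 else 0) * ?p \<gamma>)"
    by (subst sum.swap, simp only: sum_distrib_right) (auto intro!: sum.cong)
  also have "\<dots> = (real n - real k) * (\<Sum>\<gamma>\<in>Gamma01 n k. ?p \<gamma>)"
    unfolding sum_distrib_left by (intro sum.cong refl) (simp only: zeros)
  also have "(\<Sum>\<gamma>\<in>Gamma01 n k. ?p \<gamma>) = \<P>(\<omega> in M. S \<omega> = s)"
    using prob_T_S_eq_sum[of "\<lambda>_. True" s] by simp
  finally show ?thesis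
    using S_pos by (simp add: cond_prob_def flip: sum_divide_distrib)
qed

end

theorem proposition4:
  fixes M :: "'w measure" and n k i :: nat and a b :: real
    and T S :: "'w \<Rightarrow> nat \<Rightarrow> nat" and s :: "nat \<Rightarrow> nat"
  assumes "symmetric_case M n k a b T S"
    and "i \<in> {1..n}"
    and "s \<in> Sigma01 n"
    and "\<P>(\<omega> in M. S \<omega> = s) > 0"
  defines "x \<equiv> num_zeros n s"
    and "\<alpha>i \<equiv> \<P>(\<omega> in M. T \<omega> i = 0 \<bar> S \<omega> = s)"
  shows "(s i = 0 \<longrightarrow> x \<in> {1..n} \<and> \<alpha>i = alpha_minus a b n x k) \<and>
    (s i = 1 \<longrightarrow> x \<in> {0..n - 1} \<and> \<alpha>i = alpha_plus a b n x k) \<and>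
    real x * alpha_minus a b n x k + (real n - real x) * alpha_plus a b n x k
      = real n - real k"
proof -
  interpret symmetric_case M n k a b T S by fact
  note posterior = cond_prob_T_zero_given_S[OF assms(3) _ assms(4), folded x_def]
  let ?X = "{j \<in> {1..n}. s j = 0}"
  have card_X: "card ?X = x"
    unfolding x_def num_zeros_eq_card[OF assms(3)] ..
  have X_le: "x \<le> n"
    unfolding x_def by (rule num_zeros_le)
  have "real n - real k = (\<Sum>j=1..n. \<P>(\<omega> in M. T \<omega> j = 0 \<bar> S \<omega> = s))"
    using sum_cond_prob_T_zero_given_S[OF assms(4)] by simp
  also have "\<dots> = (\<Sum>j\<in>{1..n} - ?X. \<P>(\<omega> in M. T \<omega> j = 0 \<bar> S \<omega> = s)) +
      (\<Sum>j\<in>?X. \<P>(\<omega> in M. T \<omega> j = 0 \<bar> S \<omega> = s))"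
    by (rule sum.subset_diff) auto
  also have "(\<Sum>j\<in>?X. \<P>(\<omega> in M. T \<omega> j = 0 \<bar> S \<omega> = s)) = (\<Sum>j\<in>?X. alpha_minus a b n x k)"
    using posterior(1) by (intro sum.cong refl) blast
  also have "(\<Sum>j\<in>{1..n} - ?X. \<P>(\<omega> in M. T \<omega> j = 0 \<bar> S \<omega> = s)) =
      (\<Sum>j\<in>{1..n} - ?X. alpha_plus a b n x k)"
  proof (intro sum.cong refl)
    fix j assume j: "j \<in> {1..n} - ?X"
    then have "s j = 1" using assms(3) by (auto dest: Sigma01_values)
    then show "\<P>(\<omega> in M. T \<omega> j = 0 \<bar> S \<omega> = s) = alpha_plus a b n x k"
      using posterior(2) j by blast
  qed
  finally have "real n - real k = real (card ({1..n} - ?X)) * alpha_plus a b n x k +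
      real (card ?X) * alpha_minus a b n x k"
    by simp
  moreover have "card ({1..n} - ?X) = n - x"
    unfolding card_X[symmetric] by (subst card_Diff_subset) auto
  ultimately have "real x * alpha_minus a b n x k + (real n - real x) * alpha_plus a b n x k
      = real n - real k"
    using X_le card_X by (simp only: of_nat_diff add.commute)
  then show ?thesis
    using posterior[OF assms(2)] unfolding \<alpha>i_def by blast
qed

end
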